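(* Let $(j_n)_{n\ge 0}$ be defined by $j_0=0$, $j_{2k}=j_k$ and $j_{2k+1}=(-1)^k$ for all $k\ge 0$, and let $s_n=1+\sum_{0\le k\le n} j_k$. Define $a_0=0$, and let $(a_n)_{n\ge 1}$ be the increasing sequence of positive integers whose odd part is of the form $4k+1$. Then $a_n+s_{a_n}=2n+1$ for all $n\ge 0$.
   Context: The odd part of a positive integer $m$ is the odd integer $m/2^{v}$ where $2^v$ is the largest power of $2$ dividing $m$. *)

theory Defs
  imports "HOL-Library.Infinite_Set" "HOL-Computational_Algebra.Primes"
begin

fun j_seq :: "nat \<Rightarrow> int" where
  "j_seq n = (if n = 0 then 0 else if even n then j_seq (n div 2) else (- 1) ^ (n div 2))"

declare j_seq.simps [simp del]

lemma j_seq_0: "j_seq 0 = 0"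
  by (simp add: j_seq.simps)

lemma j_seq_even: "j_seq (2 * k) = j_seq k"
  by (cases "k = 0") (simp_all add: j_seq.simps [of "2 * k"])

lemma j_seq_odd: "j_seq (2 * k + 1) = (- 1) ^ k"
  by (simp add: j_seq.simps [of "Suc (2 * k)"])

definition s_seq :: "nat \<Rightarrow> int" where
  "s_seq n = 1 + (\<Sum>k = 0..n. j_seq k)"

definition odd_part :: "nat \<Rightarrow> nat" where
  "odd_part m = m div 2 ^ multiplicity 2 m"

definition A_set :: "nat set" where
  "A_set = {m. m > 0 \<and> (\<exists>k. odd_part m = 4 * k + 1)}"

text \<open>
  The library function \<open>enumerate\<close> lists a set increasingly from index 0; since \<open>A_set\<close> is
  infinite (\<open>infinite_A_set\<close> below), \<open>a_seq 1, a_seq 2, \<dots>\<close> is its increasing enumeration.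
\<close>

fun a_seq :: "nat \<Rightarrow> nat" where
  "a_seq 0 = 0"
| "a_seq (Suc n) = enumerate A_set n"

lemma infinite_A_set: "infinite A_set"
proof -
  have "4 * k + 1 \<in> A_set" for k :: nat
  proof -
    have "\<not> 2 dvd 4 * k + 1"
      by presburger
    then have "multiplicity 2 (4 * k + 1) = 0"
      by (rule not_dvd_imp_multiplicity_0)
    then show ?thesis
      by (simp add: A_set_def odd_part_def)
  qed
  then have "range (\<lambda>k. 4 * k + 1) \<subseteq> A_set"
    by blast
  moreover have "infinite (range (\<lambda>k::nat. 4 * k + 1))"
    by (rule range_inj_infinite) (simp add: inj_on_def)
  ultimately show ?thesis
    by (rule infinite_super)
qed

end

theory Submission
  imports Defs
begin

text \<open>
  For \<open>m > 0\<close>, \<open>j_seq m\<close> is \<open>1\<close> or \<open>-1\<close> according as \<open>m\<close> lies in \<open>A_set\<close> or not. Hence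
  \<open>s_seq m = 1 + c - (m - c)\<close>, where \<open>c\<close> counts the elements of \<open>A_set\<close> up to \<open>m\<close>,
  and \<open>c = n\<close> for \<open>m = a_seq n\<close>.
\<close>

lemma odd_part_double: "m > 0 \<Longrightarrow> odd_part (2 * m) = odd_part m"
  by (simp add: odd_part_def multiplicity_times_same)

lemma odd_part_odd: "odd m \<Longrightarrow> odd_part m = m"
  by (simp add: odd_part_def not_dvd_imp_multiplicity_0)

lemma double_mem_A_set_iff: "m > 0 \<Longrightarrow> 2 * m \<in> A_set \<longleftrightarrow> m \<in> A_set"
  by (simp add: A_set_def odd_part_double)

lemma odd_mem_A_set_iff: "2 * k + 1 \<in> A_set \<longleftrightarrow> even k"
proof -
  have "(\<exists>i. 2 * k + 1 = 4 * i + 1) \<longleftrightarrow> even k"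
    by presburger
  then show ?thesis
    by (simp add: A_set_def odd_part_odd)
qed

text \<open>Membership in \<open>A_set\<close>, like \<open>j_seq\<close>, is unchanged by doubling,
  and at \<open>2 * k + 1\<close> both depend only on the parity of \<open>k\<close>.\<close>

lemma j_seq_eq: "m > 0 \<Longrightarrow> j_seq m = (if m \<in> A_set then 1 else - 1)"
proof (induction m rule: less_induct)
  case (less m)
  show ?case
  proof (cases "even m")
    case True
    then obtain k where "m = 2 * k" ..
    with less show ?thesis
      by (simp add: j_seq_even double_mem_A_set_iff)
  next
    case False
    then obtain k where "m = 2 * k + 1" ..
    then show ?thesis
      by (simp only: j_seq_odd odd_mem_A_set_iff) simp
  qed
qed

lemma zero_notin_A_set: "0 \<notin> A_set"
  by (simp add: A_set_def)

lemma s_seq_eq: "s_seq m = 1 + 2 * int (card (A_set \<inter> {..m})) - int m"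
proof (induction m)
  case 0
  then show ?case
    by (simp add: s_seq_def j_seq_0 zero_notin_A_set)
next
  case (Suc m)
  have "s_seq (Suc m) = s_seq m + j_seq (Suc m)"
    by (simp add: s_seq_def)
  with Suc show ?case
    by (simp add: j_seq_eq atMost_Suc)
qed

text \<open>Enumeration is strictly increasing, so these elements are its values at the indices 0 to
  \<open>n\<close>.\<close>

lemma card_Int_atMost_enumerate:
  fixes S :: "nat set"
  assumes "infinite S"
  shows "card (S \<inter> {..enumerate S n}) = Suc n"
proof -
  have "S \<inter> {..enumerate S n} = enumerate S ` {..n}"
    using assms enumerate_Ex[OF assms] by (force simp: enumerate_in_set)
  moreover have "inj_on (enumerate S) {..n}"
    using inj_enumerate[OF assms] by (rule inj_on_subset) simp
  ultimately show ?thesis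
    by (simp add: card_image)
qed

theorem theorem6:
  fixes n :: nat
  shows "int (a_seq n) + s_seq (a_seq n) = 2 * int n + 1"
proof (cases n)
  case 0
  then show ?thesis
    by (simp add: s_seq_eq zero_notin_A_set)
next
  case (Suc k)
  \<comment> \<open>Here \<open>a_seq n\<close> is \<open>enumerate A_set k\<close>, whose index
    starts at 0, so the count up to it is \<open>Suc k\<close>, which is \<open>n\<close>.\<close>
  then show ?thesis
    by (simp add: s_seq_eq card_Int_atMost_enumerate infinite_A_set)
qed

end
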